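(* Let $\Gamma$ be a connected irreducible well-covered CIS graph with $\omega(\Gamma)\leq 3$. Then $\Gamma$ is isomorphic to $K_1$, $K_2$, $K_3$ or $L(K_{3,3})$.
   Context: All graphs are finite, simple and undirected (with non-empty vertex set). A clique (respectively, stable set) is a set of pairwise adjacent (respectively, pairwise non-adjacent) vertices; "maximal" means maximal with respect to inclusion. $\omega(\Gamma)$ is the largest cardinality of a clique of $\Gamma$. A graph is CIS if every maximal stable set and every maximal clique have non-empty intersection. A graph is well-covered if all its maximal stable sets have the same size. A graph is irreducible if no two distinct vertices have the same (open) neighborhood $N(v)$. $K_n$ is the complete graph of order $n$, $K_{m,n}$ is the complete bipartite graph with parts of sizes $m$ and $n$, and $L(\Gamma)$ is the line graph of $\Gamma$: its vertices are the edges of $\Gamma$, two distinct edges being adjacent if and only if they share an endpoint. *)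

theory Defs
  imports "Graph_Theory.Graph_Theory"
begin

text \<open>A finite simple undirected graph is a \<^const>\<open>pair_graph\<close>: an edge between
  \<open>u\<close> and \<open>v\<close> is the pair of arcs \<open>(u, v)\<close> and \<open>(v, u)\<close>. The null graph is a
  \<^const>\<open>pair_graph\<close>, but it is not \<^const>\<open>connected\<close>.\<close>

definition is_clique :: "'a pair_pre_digraph \<Rightarrow> 'a set \<Rightarrow> bool" where
  "is_clique G C \<longleftrightarrow> C \<subseteq> pverts G \<and> (\<forall>u\<in>C. \<forall>v\<in>C. u \<noteq> v \<longrightarrow> (u, v) \<in> parcs G)"

definition is_stable :: "'a pair_pre_digraph \<Rightarrow> 'a set \<Rightarrow> bool" where
  "is_stable G S \<longleftrightarrow> S \<subseteq> pverts G \<and> (\<forall>u\<in>S. \<forall>v\<in>S. u \<noteq> v \<longrightarrow> (u, v) \<notin> parcs G)"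

definition maximal_clique :: "'a pair_pre_digraph \<Rightarrow> 'a set \<Rightarrow> bool" where
  "maximal_clique G C \<longleftrightarrow> is_clique G C \<and> (\<forall>D. is_clique G D \<and> C \<subseteq> D \<longrightarrow> D = C)"

definition maximal_stable :: "'a pair_pre_digraph \<Rightarrow> 'a set \<Rightarrow> bool" where
  "maximal_stable G S \<longleftrightarrow> is_stable G S \<and> (\<forall>T. is_stable G T \<and> S \<subseteq> T \<longrightarrow> T = S)"

definition clique_number :: "'a pair_pre_digraph \<Rightarrow> nat" where
  "clique_number G = Max (card ` {C. is_clique G C})"

definition CIS :: "'a pair_pre_digraph \<Rightarrow> bool" where
  "CIS G \<longleftrightarrow> (\<forall>S C. maximal_stable G S \<and> maximal_clique G C \<longrightarrow> S \<inter> C \<noteq> {})"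

definition well_covered :: "'a pair_pre_digraph \<Rightarrow> bool" where
  "well_covered G \<longleftrightarrow> (\<forall>S T. maximal_stable G S \<and> maximal_stable G T \<longrightarrow> card S = card T)"

definition nbhd :: "'a pair_pre_digraph \<Rightarrow> 'a \<Rightarrow> 'a set" where
  "nbhd G v = {u. (v, u) \<in> parcs G}"

definition irreducible_graph :: "'a pair_pre_digraph \<Rightarrow> bool" where
  "irreducible_graph G \<longleftrightarrow>
     (\<forall>u\<in>pverts G. \<forall>v\<in>pverts G. u \<noteq> v \<longrightarrow> nbhd G u \<noteq> nbhd G v)"

definition complete_graph :: "nat \<Rightarrow> nat pair_pre_digraph" where
  "complete_graph n =
     \<lparr> pverts = {..<n}, parcs = {(u, v). u < n \<and> v < n \<and> u \<noteq> v} \<rparr>"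

definition complete_bipartite_graph :: "nat \<Rightarrow> nat \<Rightarrow> (nat + nat) pair_pre_digraph" where
  "complete_bipartite_graph m n =
     \<lparr> pverts = Inl ` {..<m} \<union> Inr ` {..<n},
       parcs = (Inl ` {..<m}) \<times> (Inr ` {..<n}) \<union> (Inr ` {..<n}) \<times> (Inl ` {..<m}) \<rparr>"

text \<open>The two arcs of an undirected edge give the same vertex \<open>{u, v}\<close> of the line graph.\<close>

definition undirected_edges :: "'a pair_pre_digraph \<Rightarrow> 'a set set" where
  "undirected_edges G = {{u, v} | u v. (u, v) \<in> parcs G}"

definition line_graph :: "'a pair_pre_digraph \<Rightarrow> 'a set pair_pre_digraph" where
  "line_graph G =
     \<lparr> pverts = undirected_edges G,
       parcs = {(e, f). e \<in> undirected_edges G \<and> f \<in> undirected_edges G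
                        \<and> e \<noteq> f \<and> e \<inter> f \<noteq> {}} \<rparr>"

definition graph_iso :: "'a pair_pre_digraph \<Rightarrow> 'b pair_pre_digraph \<Rightarrow> bool" where
  "graph_iso G H \<longleftrightarrow> digraph_iso (with_proj G) (with_proj H)"

lemma graph_iso_iff:
  assumes "pair_graph G"
  shows "graph_iso G H \<longleftrightarrow>
    (\<exists>f. bij_betw f (pverts G) (pverts H) \<and> parcs H = (\<lambda>(u, v). (f u, f v)) ` parcs G)"
proof
  interpret pair_graph G by fact
  assume "graph_iso G H"
  then obtain h where h: "pre_digraph.digraph_isomorphism (with_proj G) h"
    and H: "with_proj H = app_iso h (with_proj G)"
    unfolding graph_iso_def digraph_iso_def by blast
  have eqs: "pverts H = iso_verts h ` pverts G" "parcs H = iso_arcs h ` parcs G"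
    "iso_tail h = fst" "iso_head h = snd"
    using H by (auto simp: with_proj_def app_iso_def)
  have ends: "iso_arcs h a = (\<lambda>(u, v). (iso_verts h u, iso_verts h v)) a" if "a \<in> parcs G" for a
    using h that eqs(3,4) unfolding pre_digraph.digraph_isomorphism_def
    by (auto intro: prod_eqI split: prod.splits)
  have "bij_betw (iso_verts h) (pverts G) (pverts H)"
    using h eqs(1) unfolding pre_digraph.digraph_isomorphism_def by (auto simp: bij_betw_def)
  moreover have "parcs H = (\<lambda>(u, v). (iso_verts h u, iso_verts h v)) ` parcs G"
    unfolding eqs(2) using ends by (rule image_cong[OF refl])
  ultimately show "\<exists>f. bij_betw f (pverts G) (pverts H)
      \<and> parcs H = (\<lambda>(u, v). (f u, f v)) ` parcs G" by blast
next
  interpret pair_graph G by fact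
  assume "\<exists>f. bij_betw f (pverts G) (pverts H) \<and> parcs H = (\<lambda>(u, v). (f u, f v)) ` parcs G"
  then obtain f where f: "inj_on f (pverts G)" "pverts H = f ` pverts G"
    "parcs H = (\<lambda>(u, v). (f u, f v)) ` parcs G" by (auto simp: bij_betw_def)
  let ?h = "\<lparr> iso_verts = f, iso_arcs = (\<lambda>(u, v). (f u, f v)), iso_head = snd, iso_tail = fst \<rparr>"
  have "inj_on (\<lambda>(u, v). (f u, f v)) (parcs G)"
    using f(1) by (auto simp: inj_on_def dest: wellformed')
  then have "pre_digraph.digraph_isomorphism (with_proj G) ?h"
    using f(1) wf_digraph unfolding pre_digraph.digraph_isomorphism_def by auto
  moreover have "with_proj H = app_iso ?h (with_proj G)"
    using f by (simp add: with_proj_def app_iso_def)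
  ultimately show "graph_iso G H" unfolding graph_iso_def digraph_iso_def by blast
qed

lemma complete_graph_is_complete: "K\<^bsub>n\<^esub> (with_proj (complete_graph n))"
  by (auto simp: complete_digraph_pair_def complete_graph_def)

lemma complete_bipartite_graph_is_complete_bipartite:
  "K\<^bsub>m,n\<^esub> (with_proj (complete_bipartite_graph m n))"
  unfolding complete_bipartite_digraph_pair_def complete_bipartite_graph_def
  by (intro conjI exI[of _ "Inl ` {..<m}"] exI[of _ "Inr ` {..<n}"])
     (auto simp: card_image)

lemma pair_graph_line_graph:
  assumes "pair_graph G"
  shows "pair_graph (line_graph G)"
proof -
  interpret pair_graph G by fact
  have "undirected_edges G \<subseteq> (\<lambda>(u, v). {u, v}) ` parcs G"
    by (auto simp: undirected_edges_def)
  then have fin: "finite (undirected_edges G)"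
    using pair_finite_arcs finite_surj by blast
  have "parcs (line_graph G) \<subseteq> undirected_edges G \<times> undirected_edges G"
    by (auto simp: line_graph_def)
  then have "finite (parcs (line_graph G))"
    using fin finite_subset by blast
  with fin show ?thesis
    by unfold_locales (auto simp: line_graph_def symmetric_def intro!: symI)
qed

end

theory Submission
  imports Defs
begin

text \<open>In a CIS graph no stable set disjoint from a maximal clique dominates it. If two triangles
  shared an edge, this would force their apexes to be twins, so by irreducibility every edge lies
  in at most one triangle; likewise an edge in no triangle has a leaf as an end. If some vertex
  \<open>s\<close> has a neighbour \<open>v\<close> with \<open>N[s] \<subseteq> N[v]\<close>, then \<open>N[v] = N[s]\<close>: otherwise either \<open>v\<close> can be
  traded in a maximal stable set for two vertices, contradicting well-coveredness, or a second
  triangle at \<open>v\<close> is dominated. By connectedness the graph is then \<open>K\<^sub>2\<close> or \<open>K\<^sub>3\<close>.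
  In the remaining case with an edge, every vertex lies in at least two triangles. Given a triangle
  and a second triangle at each of its vertices, the non-domination property forces these nine
  vertices to form a 3 by 3 rook's graph; uniqueness of triangles makes all degrees equal to four,
  so these nine vertices are the whole graph.\<close>

section \<open>Isomorphisms via a common index set\<close>

lemma graph_isoI:
  assumes "pair_graph G" "pair_graph H"
    and g: "bij_betw g I (pverts G)" and h: "bij_betw h I (pverts H)"
    and arcs: "\<And>i j. i \<in> I \<Longrightarrow> j \<in> I \<Longrightarrow> (g i, g j) \<in> parcs G \<longleftrightarrow> (h i, h j) \<in> parcs H"
  shows "graph_iso G H"
proof -
  interpret G: pair_graph G by fact
  interpret H: pair_graph H by fact
  let ?f = "h \<circ> inv_into I g"
  have f: "?f (g i) = h i" if "i \<in> I" for i
    using g that by (simp add: bij_betw_def)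
  have "bij_betw ?f (pverts G) (pverts H)"
    using bij_betw_trans[OF bij_betw_inv_into[OF g] h] .
  moreover have "parcs H = (\<lambda>(u, v). (?f u, ?f v)) ` parcs G"
  proof (intro set_eqI iffI)
    fix e assume e: "e \<in> parcs H"
    then obtain u v where uv: "e = (u, v)" "u \<in> pverts H" "v \<in> pverts H"
      by (cases e) (auto dest: H.wellformed')
    then obtain i j where ij: "i \<in> I" "j \<in> I" "u = h i" "v = h j"
      unfolding bij_betw_imp_surj_on[OF h, symmetric] by blast
    then have "(g i, g j) \<in> parcs G" using arcs e uv by auto
    moreover have "e = (\<lambda>(u, v). (?f u, ?f v)) (g i, g j)" using f ij uv by simp
    ultimately show "e \<in> (\<lambda>(u, v). (?f u, ?f v)) ` parcs G" by (rule rev_image_eqI)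
  next
    fix e assume "e \<in> (\<lambda>(u, v). (?f u, ?f v)) ` parcs G"
    then obtain u v where uv: "(u, v) \<in> parcs G" "e = (?f u, ?f v)" by auto
    then have "u \<in> pverts G" "v \<in> pverts G" by (auto dest: G.wellformed')
    then obtain i j where "i \<in> I" "j \<in> I" "u = g i" "v = g j"
      unfolding bij_betw_imp_surj_on[OF g, symmetric] by blast
    then show "e \<in> parcs H" using uv f arcs by simp
  qed
  ultimately show ?thesis using graph_iso_iff[OF assms(1)] by blast
qed

lemma pair_graph_complete_graph: "pair_graph (complete_graph n)"
proof -
  have "finite {(u, v). u < n \<and> v < n \<and> u \<noteq> v}"
    by (rule finite_subset[of _ "{..<n} \<times> {..<n}"]) auto
  then show ?thesis
    by unfold_locales (auto simp: complete_graph_def symmetric_def intro!: symI)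
qed

lemma graph_iso_complete_graph:
  assumes "pair_graph G" "card (pverts G) = n" "is_clique G (pverts G)"
  shows "graph_iso G (complete_graph n)"
proof -
  interpret pair_graph G by fact
  obtain g where g: "bij_betw g {..<n} (pverts G)"
    using assms(2) pair_finite_verts ex_bij_betw_nat_finite[of "pverts G"]
    by (auto simp: atLeast0LessThan)
  show ?thesis
  proof (rule graph_isoI[OF assms(1) pair_graph_complete_graph g])
    show "bij_betw id {..<n} (pverts (complete_graph n))" by (simp add: complete_graph_def)
    fix i j assume "i \<in> {..<n}" "j \<in> {..<n}"
    moreover from this have "g i \<in> pverts G" "g j \<in> pverts G" "g i = g j \<longleftrightarrow> i = j"
      using bij_betwE[OF g] bij_betw_imp_inj_on[OF g] by (auto dest: inj_onD)
    ultimately show "(g i, g j) \<in> parcs G \<longleftrightarrow> (id i, id j) \<in> parcs (complete_graph n)"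
      using assms(3) pair_no_loops[of "(g i, g j)"]
      by (auto simp: complete_graph_def is_clique_def)
  qed
qed

lemma pair_graph_complete_bipartite_graph: "pair_graph (complete_bipartite_graph m n)"
  by unfold_locales (auto simp: complete_bipartite_graph_def symmetric_def intro!: symI)

text \<open>The edge \<open>{Inl i, Inr j}\<close> corresponds to the cell \<open>(i, j)\<close> of
  an m by n board. Two edges share an endpoint iff their cells share a row or a column, so the line
  graph is the rook's graph of the board.\<close>

lemma graph_iso_line_graph_complete_bipartite_graph:
  assumes "pair_graph G" and g: "bij_betw g ({..<m} \<times> {..<n}) (pverts G)"
    and arcs: "\<And>i j k l. i < m \<Longrightarrow> j < n \<Longrightarrow> k < m \<Longrightarrow> l < n \<Longrightarrow>
      (g (i, j), g (k, l)) \<in> parcs G \<longleftrightarrow> (i, j) \<noteq> (k, l) \<and> (i = k \<or> j = l)"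
  shows "graph_iso G (line_graph (complete_bipartite_graph m n))"
proof -
  let ?L = "line_graph (complete_bipartite_graph m n)"
  let ?h = "\<lambda>(i, j). {Inl i, Inr j} :: (nat + nat) set"
  have edges: "undirected_edges (complete_bipartite_graph m n) = ?h ` ({..<m} \<times> {..<n})"
    unfolding undirected_edges_def complete_bipartite_graph_def by auto
  have inj: "inj_on ?h ({..<m} \<times> {..<n})"
    by (auto simp: inj_on_def doubleton_eq_iff)
  show ?thesis
  proof (rule graph_isoI[OF assms(1) _ g])
    show "pair_graph ?L"
      by (intro pair_graph_line_graph pair_graph_complete_bipartite_graph)
    show "bij_betw ?h ({..<m} \<times> {..<n}) (pverts ?L)"
      using inj edges by (simp add: bij_betw_def line_graph_def)
    fix p q assume "p \<in> {..<m} \<times> {..<n}" "q \<in> {..<m} \<times> {..<n}"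
    then show "(g p, g q) \<in> parcs G \<longleftrightarrow> (?h p, ?h q) \<in> parcs ?L"
      using arcs by (auto simp: line_graph_def edges doubleton_eq_iff)
  qed
qed

section \<open>Adjacency, stable sets and connectedness\<close>

context pair_graph
begin

abbreviation adj :: "'a \<Rightarrow> 'a \<Rightarrow> bool" where
  "adj u v \<equiv> (u, v) \<in> parcs G"

lemma adj_sym: "adj u v \<Longrightarrow> adj v u"
  by (rule arcs_symmetric)

lemma adj_irrefl: "\<not> adj v v"
  using pair_no_loops[of "(v, v)"] by auto

lemma adj_verts: "adj u v \<Longrightarrow> u \<in> pverts G \<and> v \<in> pverts G"
  by (auto dest: wellformed')

lemma finite_is_stable: "is_stable G S \<Longrightarrow> finite S"
  using pair_finite_verts by (auto simp: is_stable_def intro: finite_subset)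

lemma ex_maximal_stable:
  assumes "is_stable G S"
  obtains T where "S \<subseteq> T" "maximal_stable G T"
proof -
  have "{T. is_stable G T} \<subseteq> Pow (pverts G)" by (auto simp: is_stable_def)
  then have "finite {T. is_stable G T}"
    using pair_finite_verts finite_subset finite_Pow_iff by metis
  from finite_has_maximal2[OF this, of S] assms that show ?thesis
    unfolding maximal_stable_def by blast
qed

text \<open>Symmetry makes a connected graph strongly connected, so each vertex is reached from
  \<open>X\<close> along a walk that never leaves \<open>X\<close>.\<close>

lemma connected_closed_eq_verts:
  assumes "Digraph_Component.connected (with_proj G)"
    and "X \<subseteq> pverts G" "X \<noteq> {}"
    and closed: "\<And>u v. u \<in> X \<Longrightarrow> adj u v \<Longrightarrow> v \<in> X"
  shows "X = pverts G"
proof -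
  have sc: "strongly_connected (with_proj G)"
    using symmetric_connected_imp_strongly_connected[OF sym_arcs assms(1)] .
  obtain x where x: "x \<in> X" using assms(3) by blast
  have "y \<in> X" if "y \<in> pverts G" for y
  proof -
    have "x \<rightarrow>\<^sup>*\<^bsub>with_proj G\<^esub> y"
      using sc assms(2) x that unfolding strongly_connected_def by auto
    then show ?thesis
    proof (induction rule: reachable_induct)
      case base
      show ?case by (rule x)
    next
      case (step u v)
      then show ?case using closed by simp
    qed
  qed
  with assms(2) show ?thesis by blast
qed

end


section \<open>Irreducible CIS graphs with clique number at most 3\<close>

locale CIS_graph_clique_le3 = pair_graph +
  assumes irreducible: "irreducible_graph G"
    and CIS: "CIS G"
    and clique_le3: "clique_number G \<le> 3"
begin

lemma no_K4:
  assumes "adj a b" "adj a c" "adj a d" "adj b c" "adj b d" "adj c d"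
  shows False
proof -
  have "{C. is_clique G C} \<subseteq> Pow (pverts G)" by (auto simp: is_clique_def)
  then have "finite {C. is_clique G C}"
    using pair_finite_verts finite_subset finite_Pow_iff by metis
  moreover have "is_clique G {a, b, c, d}"
    using assms adj_verts adj_sym unfolding is_clique_def by blast
  ultimately have "card {a, b, c, d} \<le> clique_number G"
    unfolding clique_number_def by (intro Max_ge) auto
  moreover have "card {a, b, c, d} = 4"
    using assms adj_irrefl by (auto simp: card_insert_if)
  ultimately show False using clique_le3 by simp
qed

text \<open>Extend \<open>S\<close> to a maximal stable set \<open>T\<close>. By CIS,
  \<open>T\<close> meets \<open>C\<close> in some \<open>c\<close>, which lies outside
  \<open>S\<close>; stability of \<open>T\<close> forbids edges from \<open>c\<close> to
  \<open>S\<close>.\<close>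

lemma maximal_clique_not_dominated:
  assumes "maximal_clique G C" "is_stable G S" "S \<inter> C = {}"
  shows "\<exists>c\<in>C. \<forall>s\<in>S. \<not> adj c s"
proof -
  obtain T where T: "S \<subseteq> T" "maximal_stable G T" using ex_maximal_stable assms(2) .
  then have "T \<inter> C \<noteq> {}" using CIS assms(1) by (simp add: CIS_def)
  then obtain c where c: "c \<in> T" "c \<in> C" by blast
  have "\<not> adj c s" if "s \<in> S" for s
  proof -
    have "s \<in> T" "c \<noteq> s" using that T(1) c assms(3) by auto
    then show ?thesis using c T(2) by (auto simp: maximal_stable_def is_stable_def)
  qed
  then show ?thesis using c by blast
qed

text \<open>Without a clique of size 4, a triangle is a maximal clique; if the claim failed,
  \<open>{x, y, z}\<close> would be a stable set dominating it. The vertices \<open>x\<close>,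
  \<open>y\<close>, \<open>z\<close> may coincide, which later applications exploit.\<close>

lemma triangle_private_neighbours_adj:
  assumes "adj a b" "adj a c" "adj b c" "adj a x" "adj b y" "adj c z"
    and "x \<notin> {a, b, c}" "y \<notin> {a, b, c}" "z \<notin> {a, b, c}"
  shows "adj x y \<or> adj x z \<or> adj y z"
proof (rule ccontr)
  assume "\<not> ?thesis"
  then have "is_stable G {x, y, z}"
    using assms adj_verts adj_sym unfolding is_stable_def by blast
  moreover have "maximal_clique G {a, b, c}"
  proof -
    have "is_clique G {a, b, c}"
      using assms adj_verts adj_sym unfolding is_clique_def by blast
    moreover have "D = {a, b, c}" if "is_clique G D" "{a, b, c} \<subseteq> D" for D
    proof -
      have "w \<in> {a, b, c}" if "w \<in> D" for w
      proof (rule ccontr)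
        assume "w \<notin> {a, b, c}"
        then have "adj a w" "adj b w" "adj c w"
          using \<open>is_clique G D\<close> \<open>{a, b, c} \<subseteq> D\<close> \<open>w \<in> D\<close> unfolding is_clique_def by auto
        then show False using no_K4 assms by blast
      qed
      with that show ?thesis by blast
    qed
    ultimately show ?thesis unfolding maximal_clique_def by blast
  qed
  moreover have "{x, y, z} \<inter> {a, b, c} = {}" using assms by auto
  ultimately show False using maximal_clique_not_dominated assms by blast
qed

lemma edge_private_neighbours_adj:
  assumes "adj a b" and no_triangle: "\<And>c. \<not> (adj a c \<and> adj b c)"
    and "adj a x" "adj b y" "x \<noteq> b" "y \<noteq> a"
  shows "adj x y"
proof (rule ccontr)
  assume "\<not> adj x y"
  then have "is_stable G {x, y}"
    using assms adj_verts adj_sym unfolding is_stable_def by blast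
  moreover have "maximal_clique G {a, b}"
  proof -
    have "is_clique G {a, b}"
      using assms(1) adj_sym[OF assms(1)] adj_verts[OF assms(1)] by (auto simp: is_clique_def)
    moreover have "D = {a, b}" if "is_clique G D" "{a, b} \<subseteq> D" for D
    proof -
      have "w \<in> {a, b}" if "w \<in> D" for w
      proof (rule ccontr)
        assume "w \<notin> {a, b}"
        then have "adj a w \<and> adj b w"
          using \<open>is_clique G D\<close> \<open>{a, b} \<subseteq> D\<close> \<open>w \<in> D\<close> unfolding is_clique_def by auto
        then show False using no_triangle by blast
      qed
      with that show ?thesis by blast
    qed
    ultimately show ?thesis unfolding maximal_clique_def by blast
  qed
  moreover have "{x, y} \<inter> {a, b} = {}" using assms(3-6) adj_irrefl by auto
  ultimately show False using maximal_clique_not_dominated assms(3,4) by blast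
qed

lemma unique_common_neighbour:
  assumes "adj a b" "adj a c" "adj b c" "adj a d" "adj b d"
  shows "c = d"
proof (rule ccontr)
  assume "c \<noteq> d"
  have sub: "nbhd G q \<subseteq> nbhd G p"
    if p: "adj a p" "adj b p" and q: "adj a q" "adj b q" and "p \<noteq> q" for p q
  proof
    fix x assume "x \<in> nbhd G q"
    then have x: "adj q x" by (simp add: nbhd_def)
    have "\<not> adj q p" using no_K4[of a b p q] assms(1) p q adj_sym by blast
    show "x \<in> nbhd G p"
    proof (cases "x = a \<or> x = b")
      case True
      then show ?thesis using p adj_sym by (auto simp: nbhd_def)
    next
      case False
      \<comment> \<open>\<open>p\<close> dominates both \<open>a\<close> and \<open>b\<close>, and \<open>x\<close> dominates the third vertex \<open>q\<close>.\<close>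
      have "adj p p \<or> adj p x \<or> adj p x"
        by (rule triangle_private_neighbours_adj[of a b q])
          (use False assms(1) p q x \<open>p \<noteq> q\<close> \<open>\<not> adj q p\<close> adj_irrefl in auto)
      then show ?thesis using adj_irrefl by (auto simp: nbhd_def)
    qed
  qed
  have "nbhd G c = nbhd G d" using sub[of c d] sub[of d c] assms \<open>c \<noteq> d\<close> by blast
  then show False
    using irreducible assms \<open>c \<noteq> d\<close> adj_verts unfolding irreducible_graph_def by blast
qed

text \<open>If both ends had a further neighbour, \<open>N(u)\<close> and \<open>N(v)\<close> would
  be completely joined and \<open>N(u)\<close> stable. Then any neighbour \<open>x\<close> of
  \<open>u\<close> other than \<open>v\<close> turns out to be a twin of \<open>v\<close>.\<close>

lemma no_triangle_imp_leaf:
  assumes uv: "adj u v" and no_triangle: "\<And>w. \<not> (adj u w \<and> adj v w)"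
  shows "nbhd G u = {v} \<or> nbhd G v = {u}"
proof (rule ccontr)
  assume "\<not> ?thesis"
  moreover have "v \<in> nbhd G u" "u \<in> nbhd G v" using uv adj_sym by (auto simp: nbhd_def)
  ultimately obtain x y where x: "adj u x" "x \<noteq> v" and y: "adj v y" "y \<noteq> u"
    by (auto simp: nbhd_def)
  have complete: "adj p q" if "adj u p" "adj v q" for p q
    using edge_private_neighbours_adj[OF uv no_triangle, of p q] that uv adj_sym by blast
  have stable: "\<not> adj p q" if "adj u p" "adj u q" for p q
  proof
    assume "adj p q"
    moreover have "adj p y" "adj q y" using complete that y by auto
    ultimately have "u = y" using unique_common_neighbour[of p q u y] that adj_sym by blast
    then show False using y by simp
  qed
  \<comment> \<open>As \<open>N(u)\<close> is stable, the edge \<open>u x\<close> lies in no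
    triangle, so its private neighbours \<open>v\<close> and \<open>q\<close> are adjacent.\<close>
  have "adj v q" if "adj x q" for q
    using edge_private_neighbours_adj[of u x v q] x uv that stable adj_sym by blast
  then have "nbhd G x = nbhd G v" using complete x by (auto simp: nbhd_def)
  then show False using irreducible x uv adj_verts unfolding irreducible_graph_def by blast
qed

text \<open>Take \<open>x\<close> at \<open>b\<close> and \<open>y\<close> at \<open>c\<close> off
  the triangle. If \<open>b x\<close> lies in a triangle with apex \<open>z\<close>, then
  \<open>y\<close> cannot be adjacent to both \<open>x\<close> and \<open>z\<close>, whose only
  common neighbour is \<open>b\<close>. Otherwise \<open>x\<close> is a leaf at
  \<open>b\<close>.\<close>

lemma triangle_ex_nonadjacent_neighbours:
  assumes "adj a b" "adj a c" "adj b c" "\<not> nbhd G b \<subseteq> {a, c}" "\<not> nbhd G c \<subseteq> {a, b}"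
  obtains x y where "adj b x" "adj c y" "x \<notin> {a, b, c}" "y \<notin> {a, b, c}" "\<not> adj x y"
proof -
  obtain x y where x: "adj b x" "x \<notin> {a, c}" and y: "adj c y" "y \<notin> {a, b}"
    using assms(4,5) by (auto simp: nbhd_def)
  have ne: "x \<noteq> b" "y \<noteq> c" using x y adj_irrefl by auto
  show ?thesis
  proof (cases "\<exists>z. adj b z \<and> adj x z")
    case True
    then obtain z where z: "adj b z" "adj x z" by blast
    have "z \<noteq> a"
      using unique_common_neighbour[of a b c x] assms(1-3) x z adj_sym by blast
    moreover have "z \<noteq> c"
      using unique_common_neighbour[of b c a x] assms(1-3) x z adj_sym by blast
    moreover have "z \<noteq> b" using z adj_irrefl by auto
    moreover have "\<not> (adj x y \<and> adj z y)"
      using unique_common_neighbour[of x z b y] x y z adj_sym by blast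
    ultimately show ?thesis using that[of x y] that[of z y] x y ne z by blast
  next
    case False
    then have "nbhd G b = {x} \<or> nbhd G x = {b}" using no_triangle_imp_leaf x(1) by blast
    then have "\<not> adj x y" using assms(3) x y by (auto simp: nbhd_def)
    then show ?thesis using that x y ne by blast
  qed
qed

end

section \<open>Well-covered graphs with a nested pair of closed neighbourhoods\<close>

locale well_covered_CIS_graph_clique_le3 = CIS_graph_clique_le3 +
  assumes well_covered: "well_covered G"
begin

lemma no_two_simplicial_neighbours:
  assumes x: "adj v x" "nbhd G x \<subseteq> insert v (nbhd G v)"
    and y: "adj v y" "nbhd G y \<subseteq> insert v (nbhd G v)"
    and xy: "x \<noteq> y" "\<not> adj x y"
  shows False
proof -
  have "is_stable G {v}" using x adj_verts unfolding is_stable_def by blast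
  then obtain S where S: "{v} \<subseteq> S" "maximal_stable G S" by (rule ex_maximal_stable)
  then have stable: "is_stable G S" by (simp add: maximal_stable_def)
  then have fin: "finite S" by (rule finite_is_stable)
  have nv: "\<not> adj v s" "\<not> adj s v" if "s \<in> S" for s
    using that S(1) stable adj_irrefl[of v] by (auto simp: is_stable_def)
  have nxy: "\<not> adj x s" "\<not> adj y s" "\<not> adj s x" "\<not> adj s y" if "s \<in> S - {v}" for s
    using that x(2) y(2) nv[of s] adj_sym[of s x] adj_sym[of s y] unfolding nbhd_def by auto
  \<comment> \<open>Trading \<open>v\<close> for \<open>x\<close> and \<open>y\<close> preserves
    stability: all neighbours of \<open>x\<close> and \<open>y\<close> lie in \<open>N[v]\<close>,
    which meets \<open>S\<close> only in \<open>v\<close>.\<close>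
  let ?S = "insert x (insert y (S - {v}))"
  have "is_stable G ?S"
    using stable nxy xy x(1) y(1) adj_verts[of v x] adj_verts[of v y] adj_sym[of y x]
    unfolding is_stable_def by auto
  then obtain T where T: "?S \<subseteq> T" "maximal_stable G T" by (rule ex_maximal_stable)
  have "x \<notin> S" "y \<notin> S" using nv x(1) y(1) by auto
  then have "card ?S = card S + 1"
    using xy(1) fin S(1) card_Suc_Diff1[of S v] by auto
  moreover have "card ?S \<le> card T"
    using T finite_is_stable by (intro card_mono) (auto simp: maximal_stable_def)
  ultimately have "card S < card T" by linarith
  moreover have "card S = card T"
    using well_covered S(2) T(2) unfolding well_covered_def by metis
  ultimately show False by simp
qed

text \<open>Suppose \<open>y\<close> in \<open>N(v)\<close> is not adjacent to \<open>s\<close>. If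
  \<open>v y\<close> lies in no triangle, \<open>y\<close> is a leaf and contradicts
  \<open>no_two_simplicial_neighbours\<close>. Otherwise a triangle \<open>v y z\<close> is
  dominated by \<open>s\<close> and two non-adjacent outer neighbours of \<open>y\<close> and
  \<open>z\<close>.\<close>

lemma simplicial_imp_nbhd_subset:
  assumes sv: "adj v s" and s: "nbhd G s \<subseteq> insert v (nbhd G v)"
  shows "nbhd G v \<subseteq> insert s (nbhd G s)"
proof (rule ccontr)
  assume "\<not> ?thesis"
  then obtain y where y: "adj v y" "y \<noteq> s" "\<not> adj s y" by (auto simp: nbhd_def)
  have not_simplicial: "\<not> nbhd G w \<subseteq> insert v (nbhd G v)"
    if "adj v w" "w \<noteq> s" "\<not> adj s w" for w
    using no_two_simplicial_neighbours[OF sv s, of w] that by blast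
  show False
  proof (cases "\<exists>z. adj v z \<and> adj y z")
    case False
    then have "nbhd G v = {y} \<or> nbhd G y = {v}" using no_triangle_imp_leaf y(1) by blast
    moreover have "s \<in> nbhd G v" using sv by (simp add: nbhd_def)
    ultimately have "nbhd G y = {v}" using y(2) by auto
    then show False using not_simplicial[OF y] by simp
  next
    case True
    then obtain z where z: "adj v z" "adj y z" by blast
    have "z \<noteq> s" using y z adj_sym by blast
    have "\<not> adj s z" using unique_common_neighbour[of v z s y] sv y z adj_sym by blast
    have "\<not> nbhd G y \<subseteq> {v, z}" "\<not> nbhd G z \<subseteq> {v, y}"
      using not_simplicial[of y] not_simplicial[of z] y z \<open>z \<noteq> s\<close> \<open>\<not> adj s z\<close>
      by (auto simp: nbhd_def)
    then obtain p q where pq: "adj y p" "adj z q" "p \<notin> {v, y, z}" "q \<notin> {v, y, z}" "\<not> adj p q"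
      using triangle_ex_nonadjacent_neighbours[of v y z] y z by blast
    have "\<not> adj v p" using unique_common_neighbour[of v y z p] y z pq by blast
    moreover have "\<not> adj v q"
      using unique_common_neighbour[of v z y q] y z pq adj_sym by blast
    ultimately have "\<not> adj s p" "\<not> adj s q" using s pq by (auto simp: nbhd_def)
    moreover have "adj s p \<or> adj s q \<or> adj p q"
      by (rule triangle_private_neighbours_adj[of v y z])
        (use sv y z pq \<open>z \<noteq> s\<close> adj_irrefl in auto)
    ultimately show False using pq by blast
  qed
qed

text \<open>The edge \<open>s v\<close> has at most one common neighbour, so \<open>N[s]\<close> has
  two or three vertices. It is closed under adjacency, hence is the whole graph.\<close>

lemma simplicial_imp_complete:
  assumes conn: "Digraph_Component.connected (with_proj G)"
    and sv: "adj v s" and s: "nbhd G s \<subseteq> insert v (nbhd G v)"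
  shows "graph_iso G (complete_graph 2) \<or> graph_iso G (complete_graph 3)"
proof -
  let ?X = "insert s (nbhd G s)"
  have vs: "adj s v" using sv by (rule adj_sym)
  have "s \<noteq> v" using vs adj_irrefl by blast
  have uniq: "u = w" if "adj s u" "adj s w" "u \<noteq> v" "w \<noteq> v" for u w
    using unique_common_neighbour[of s v u w] that s vs by (auto simp: nbhd_def)
  have X: "?X = pverts G"
  proof (rule connected_closed_eq_verts[OF conn])
    show "?X \<subseteq> pverts G" using vs by (auto simp: nbhd_def dest: adj_verts)
    fix u w assume u: "u \<in> ?X" and uw: "adj u w"
    consider "u = s" | "u = v" | "adj s u" "u \<noteq> v" using u by (auto simp: nbhd_def)
    then show "w \<in> ?X"
    proof cases
      case 1
      then show ?thesis using uw by (simp add: nbhd_def)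
    next
      case 2
      then show ?thesis
        using simplicial_imp_nbhd_subset[OF sv s] uw by (auto simp: nbhd_def)
    next
      case 3
      have "adj u v" using 3 s adj_sym[of v u] by (auto simp: nbhd_def)
      \<comment> \<open>Since \<open>N[s] = {s, v, u}\<close>, the vertex \<open>u\<close> can take
        over the role of \<open>v\<close>.\<close>
      then have "nbhd G s \<subseteq> insert u (nbhd G u)"
        using uniq 3 by (auto simp: nbhd_def)
      then show ?thesis
        using simplicial_imp_nbhd_subset[OF adj_sym[OF 3(1)]] uw by (auto simp: nbhd_def)
    qed
  qed simp
  show ?thesis
  proof (cases "\<exists>u. adj s u \<and> u \<noteq> v")
    case False
    then have "nbhd G s = {v}" using vs unfolding nbhd_def by blast
    then have V: "pverts G = {s, v}" using X by simp
    have "is_clique G (pverts G)" unfolding V is_clique_def using V sv vs by auto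
    moreover have "card (pverts G) = 2" unfolding V using \<open>s \<noteq> v\<close> by simp
    ultimately show ?thesis using graph_iso_complete_graph pair_graph by blast
  next
    case True
    then obtain u where u: "adj s u" "u \<noteq> v" by blast
    then have "nbhd G s = {v, u}" using vs uniq unfolding nbhd_def by blast
    then have V: "pverts G = {s, v, u}" using X by simp
    have vu: "adj v u" using u s by (auto simp: nbhd_def)
    have "is_clique G (pverts G)"
      unfolding V is_clique_def using V sv vs u vu adj_sym[of s u] adj_sym[of v u] by auto
    moreover have "s \<noteq> u" using u adj_irrefl by blast
    then have "card (pverts G) = 3" unfolding V using \<open>s \<noteq> v\<close> u(2) by simp
    ultimately show ?thesis using graph_iso_complete_graph pair_graph by blast
  qed
qed

end

section \<open>The remaining case: reconstruction of the rook's graph\<close>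

locale simplicial_free_CIS_graph = CIS_graph_clique_le3 +
  assumes not_simplicial: "adj v s \<Longrightarrow> \<not> nbhd G s \<subseteq> insert v (nbhd G v)"
begin

definition triangle :: "'a \<Rightarrow> 'a \<Rightarrow> 'a \<Rightarrow> bool" where
  "triangle a b c \<longleftrightarrow> adj a b \<and> adj a c \<and> adj b c"

lemma triangle_rotate: "triangle a b c \<Longrightarrow> triangle b c a"
  and triangle_swap: "triangle a b c \<Longrightarrow> triangle a c b"
  using adj_sym by (auto simp: triangle_def)

lemma triangle_unique: "triangle a b c \<Longrightarrow> triangle a b d \<Longrightarrow> c = d"
  using unique_common_neighbour by (auto simp: triangle_def)

lemma triangle_distinct: "triangle a b c \<Longrightarrow> distinct [a, b, c]"
  using adj_irrefl by (auto simp: triangle_def)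

text \<open>The closed neighbourhood of a leaf lies in that of its neighbour, so there are no leaves
  here.\<close>

lemma edge_in_triangle:
  assumes "adj u v"
  obtains w where "triangle u v w"
proof -
  have "nbhd G u \<noteq> {v}" "nbhd G v \<noteq> {u}"
    using not_simplicial[of v u] not_simplicial[of u v] assms adj_sym[OF assms] by auto
  then show ?thesis
    using no_triangle_imp_leaf[OF assms] assms that unfolding triangle_def by blast
qed

lemma new_triangle:
  assumes abc: "triangle a b c" and x: "adj a x" "x \<notin> {b, c}"
  obtains y where "triangle a x y" "x \<notin> {a, b, c}" "y \<notin> {a, b, c}"
proof -
  obtain y where y: "triangle a x y" using edge_in_triangle x(1) .
  have "y \<noteq> b" using triangle_unique[of a b c x] triangle_swap y abc x by blast
  moreover have "y \<noteq> c" using triangle_unique[of a c b x] triangle_swap y abc x by blast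
  ultimately show ?thesis using that y triangle_distinct[OF y] x by auto
qed

lemma second_triangle:
  assumes abc: "triangle a b c"
  obtains x y where "triangle a x y" "x \<notin> {a, b, c}" "y \<notin> {a, b, c}"
proof -
  have "\<not> nbhd G a \<subseteq> {b, c}"
    using not_simplicial[of b a] abc adj_sym[of a b] by (auto simp: triangle_def nbhd_def)
  then obtain x where "adj a x" "x \<notin> {b, c}" by (auto simp: nbhd_def)
  then show ?thesis using new_triangle[OF abc] that by blast
qed

text \<open>Each of the eight transversals of the pairs \<open>{a\<^sub>1, a\<^sub>2}\<close>, \<open>{b\<^sub>1, b\<^sub>2}\<close>, \<open>{c\<^sub>1, c\<^sub>2}\<close>
  spans an edge, while the edges between two pairs form a matching: this is only possible if all
  three matchings are perfect and fit together to two triangles.\<close>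

lemma transversal_triangles:
  assumes abc: "triangle a b c"
    and a12: "triangle a a1 a2" "a1 \<notin> {a, b, c}" "a2 \<notin> {a, b, c}"
    and b12: "triangle b b1 b2" "b1 \<notin> {a, b, c}" "b2 \<notin> {a, b, c}"
    and c12: "triangle c c1 c2" "c1 \<notin> {a, b, c}" "c2 \<notin> {a, b, c}"
  shows "triangle a1 b1 c1 \<and> triangle a2 b2 c2 \<or> triangle a1 b1 c2 \<and> triangle a2 b2 c1 \<or>
         triangle a1 b2 c1 \<and> triangle a2 b1 c2 \<or> triangle a1 b2 c2 \<and> triangle a2 b1 c1"
proof -
  have matching: "\<not> (adj u w \<and> adj v w)" "\<not> (adj w u \<and> adj w v)"
    if "triangle p u v" "w \<noteq> p" for p u v w
    using unique_common_neighbour[of u v p w] that adj_sym unfolding triangle_def by blast+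
  have trans: "adj x y \<or> adj x z \<or> adj y z"
    if "x = a1 \<or> x = a2" "y = b1 \<or> y = b2" "z = c1 \<or> z = c2" for x y z
    using triangle_private_neighbours_adj[of a b c x y z] that assms
    unfolding triangle_def by auto
  have ab: "\<not> (adj a1 b1 \<and> adj a2 b1)" "\<not> (adj a1 b2 \<and> adj a2 b2)"
    "\<not> (adj a1 b1 \<and> adj a1 b2)" "\<not> (adj a2 b1 \<and> adj a2 b2)"
    using matching[OF a12(1)] matching[OF b12(1)] assms by auto
  have ac: "\<not> (adj a1 c1 \<and> adj a2 c1)" "\<not> (adj a1 c2 \<and> adj a2 c2)"
    "\<not> (adj a1 c1 \<and> adj a1 c2)" "\<not> (adj a2 c1 \<and> adj a2 c2)"
    using matching[OF a12(1)] matching[OF c12(1)] assms by auto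
  have bc: "\<not> (adj b1 c1 \<and> adj b2 c1)" "\<not> (adj b1 c2 \<and> adj b2 c2)"
    "\<not> (adj b1 c1 \<and> adj b1 c2)" "\<not> (adj b2 c1 \<and> adj b2 c2)"
    using matching[OF b12(1)] matching[OF c12(1)] assms by auto
  show ?thesis
    unfolding triangle_def
    using ab ac bc trans[of a1 b1 c1] trans[of a1 b1 c2] trans[of a1 b2 c1] trans[of a1 b2 c2]
      trans[of a2 b1 c1] trans[of a2 b1 c2] trans[of a2 b2 c1] trans[of a2 b2 c2]
    by argo
qed

text \<open>A third triangle at \<open>a\<close> would impose, just like \<open>a a1 a2\<close>, a
  perfect matching between the pairs at \<open>b\<close> and at \<open>c\<close>. Neither equal nor
  different matchings are possible, so \<open>a\<close> has degree four.\<close>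

lemma nbhd_two_triangles:
  assumes abc: "triangle a b c"
    and a12: "triangle a a1 a2" "a1 \<notin> {a, b, c}" "a2 \<notin> {a, b, c}"
  shows "adj a x \<longleftrightarrow> x \<in> {b, c, a1, a2}"
proof
  assume "x \<in> {b, c, a1, a2}"
  then show "adj a x" using abc a12(1) by (auto simp: triangle_def)
next
  assume x: "adj a x"
  have bac: "triangle b a c" and cab: "triangle c a b"
    using abc triangle_rotate triangle_swap by blast+
  obtain b1 b2 where b12: "triangle b b1 b2" "b1 \<notin> {a, b, c}" "b2 \<notin> {a, b, c}"
    using second_triangle[OF bac] by (metis insert_commute)
  obtain c1 c2 where c12: "triangle c c1 c2" "c1 \<notin> {a, b, c}" "c2 \<notin> {a, b, c}"
    using second_triangle[OF cab] by (metis insert_commute)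
  show "x \<in> {b, c, a1, a2}"
  proof (rule ccontr)
    assume nx: "x \<notin> {b, c, a1, a2}"
    then obtain y where y: "triangle a x y" "x \<notin> {a, b, c}" "y \<notin> {a, b, c}"
      using new_triangle[OF abc x] by blast
    have "y \<noteq> a1" "y \<noteq> a2"
      using triangle_unique[of a a1 a2 x] triangle_unique[of a a2 a1 x] nx y(1) a12(1) triangle_swap
      by blast+
    \<comment> \<open>The pairs \<open>{a\<^sub>1, a\<^sub>2}\<close> and \<open>{x, y}\<close> would complete the same edge between
      \<open>{b\<^sub>1, b\<^sub>2}\<close> and \<open>{c\<^sub>1, c\<^sub>2}\<close> to a triangle.\<close>
    have differ: "\<not> (triangle p q r \<and> triangle w q r)" if "p \<in> {a1, a2}" "w \<in> {x, y}" for p q r w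
      using triangle_unique[of q r p w] triangle_rotate that nx \<open>y \<noteq> a1\<close> \<open>y \<noteq> a2\<close> by blast
    \<comment> \<open>Different matchings would join \<open>q\<close> to both \<open>c1\<close> and
      \<open>c2\<close>, whose only common neighbour is \<open>c\<close>.\<close>
    have matching: "\<not> (triangle p q c1 \<and> triangle w q c2)" if "q \<in> {b1, b2}" for p q w
      using unique_common_neighbour[of c1 c2 c q] c12 that b12 adj_sym
      unfolding triangle_def by blast
    show False
      using transversal_triangles[OF abc a12 b12 c12] transversal_triangles[OF abc y b12 c12]
        differ matching by blast
  qed
qed

lemma line_graph_K33:
  assumes conn: "Digraph_Component.connected (with_proj G)" and edge: "adj u v"
  shows "graph_iso G (line_graph (complete_bipartite_graph 3 3))"
proof -
  obtain a0 b0 c0 where r0: "triangle a0 b0 c0" using edge_in_triangle[OF edge] by blast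
  have bac: "triangle b0 a0 c0" and cab: "triangle c0 a0 b0"
    using r0 triangle_rotate triangle_swap by blast+
  obtain a1 a2 where a: "triangle a0 a1 a2" "a1 \<notin> {a0, b0, c0}" "a2 \<notin> {a0, b0, c0}"
    using second_triangle[OF r0] by blast
  obtain b b' where b: "triangle b0 b b'" "b \<notin> {a0, b0, c0}" "b' \<notin> {a0, b0, c0}"
    using second_triangle[OF bac] by (metis insert_commute)
  obtain c c' where c: "triangle c0 c c'" "c \<notin> {a0, b0, c0}" "c' \<notin> {a0, b0, c0}"
    using second_triangle[OF cab] by (metis insert_commute)
  \<comment> \<open>Renaming within the pairs \<open>b\<close>, \<open>b'\<close> and
    \<open>c\<close>, \<open>c'\<close> merges the four outcomes into one. Equal letters now form
    the columns of the board and equal indices its rows.\<close>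
  obtain b1 b2 c1 c2 where r1: "triangle a1 b1 c1" and r2: "triangle a2 b2 c2"
    and bs: "b1 = b \<and> b2 = b' \<or> b1 = b' \<and> b2 = b" and cs: "c1 = c \<and> c2 = c' \<or> c1 = c' \<and> c2 = c"
    using transversal_triangles[OF r0 a b c] by blast
  have b12: "triangle b0 b1 b2" "b1 \<notin> {a0, b0, c0}" "b2 \<notin> {a0, b0, c0}"
    and c12: "triangle c0 c1 c2" "c1 \<notin> {a0, b0, c0}" "c2 \<notin> {a0, b0, c0}"
    using b c bs cs triangle_swap by blast+
  have sep: "p \<noteq> q" if "triangle u v w" "adj u p" "adj v q" "q \<noteq> w" for u v w p q
    using unique_common_neighbour[of u v w p] that by (auto simp: triangle_def)
  \<comment> \<open>Among the six vertices off \<open>r0\<close>, these are the pairs in no common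
    row or column; all others are distinct as members of one triangle.\<close>
  have "a1 \<noteq> b2" "a2 \<noteq> b1" "a1 \<noteq> c2" "a2 \<noteq> c1" "b1 \<noteq> c2" "b2 \<noteq> c1"
    using sep[OF r0, of a1 b2] sep[OF r0, of a2 b1]
      sep[OF triangle_swap[OF r0], of a1 c2] sep[OF triangle_swap[OF r0], of a2 c1]
      sep[OF triangle_rotate[OF r0], of b1 c2] sep[OF triangle_rotate[OF r0], of b2 c1]
      a b12 c12 by (auto simp: triangle_def)
  then have dist: "distinct [a0, b0, c0, a1, b1, c1, a2, b2, c2]"
    using a b12 c12 triangle_distinct[OF r0] triangle_distinct[OF r1] triangle_distinct[OF r2]
      triangle_distinct[OF a(1)] triangle_distinct[OF b12(1)] triangle_distinct[OF c12(1)]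
    by auto
  have rot: "triangle q r p" "triangle r p q" if "triangle p q r" for p q r
    using that triangle_rotate by blast+
  note tris = r0 r1 r2 a(1) b12(1) c12(1)
  note tris' = tris rot(1)[OF r0] rot(1)[OF r1] rot(1)[OF r2] rot(1)[OF a(1)]
    rot(1)[OF b12(1)] rot(1)[OF c12(1)] rot(2)[OF r0] rot(2)[OF r1] rot(2)[OF r2] rot(2)[OF a(1)]
    rot(2)[OF b12(1)] rot(2)[OF c12(1)]
  \<comment> \<open>Each vertex lies in its row triangle and its column triangle, which together
    exhaust its neighbourhood.\<close>
  have adj_iff:
    "\<And>x. adj a0 x \<longleftrightarrow> x \<in> {b0, c0, a1, a2}" "\<And>x. adj b0 x \<longleftrightarrow> x \<in> {c0, a0, b1, b2}"
    "\<And>x. adj c0 x \<longleftrightarrow> x \<in> {a0, b0, c1, c2}" "\<And>x. adj a1 x \<longleftrightarrow> x \<in> {b1, c1, a2, a0}"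
    "\<And>x. adj b1 x \<longleftrightarrow> x \<in> {c1, a1, b2, b0}" "\<And>x. adj c1 x \<longleftrightarrow> x \<in> {a1, b1, c2, c0}"
    "\<And>x. adj a2 x \<longleftrightarrow> x \<in> {b2, c2, a0, a1}" "\<And>x. adj b2 x \<longleftrightarrow> x \<in> {c2, a2, b0, b1}"
    "\<And>x. adj c2 x \<longleftrightarrow> x \<in> {a2, b2, c0, c1}"
    by (rule nbhd_two_triangles; use tris' dist in auto)+
  let ?X = "{a0, b0, c0, a1, b1, c1, a2, b2, c2}"
  have X: "?X = pverts G"
  proof (rule connected_closed_eq_verts[OF conn])
    show "?X \<subseteq> pverts G" using tris adj_verts unfolding triangle_def by blast
    show "y \<in> ?X" if "x \<in> ?X" "adj x y" for x y
      using that by (elim insertE emptyE; simp add: adj_iff; blast)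
  qed simp
  let ?I = "{..<3::nat} \<times> {..<3::nat}"
  let ?g = "\<lambda>(i, j). [[a0, b0, c0], [a1, b1, c1], [a2, b2, c2]] ! i ! j"
  have I: "{..<3::nat} = {0, 1, 2}" by auto
  have img: "?g ` ?I = pverts G" unfolding I X[symmetric] by auto
  \<comment> \<open>Injectivity follows by counting: nine cells are mapped onto nine
    vertices.\<close>
  have "card ?X = 9" using distinct_card[OF dist] by simp
  then have "card (?g ` ?I) = card ?I" unfolding img X by simp
  then have "inj_on ?g ?I" by (intro eq_card_imp_inj_on) auto
  with img have bij: "bij_betw ?g ?I (pverts G)" by (simp add: bij_betw_def)
  show ?thesis
  proof (rule graph_iso_line_graph_complete_bipartite_graph[OF pair_graph bij])
    have dist_rev: "distinct [c2, b2, a2, c1, b1, a1, c0, b0, a0]"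
      using distinct_rev[of "[a0, b0, c0, a1, b1, c1, a2, b2, c2]"] dist
      by (simp only: rev.simps append.simps)
    \<comment> \<open>The inequalities are needed as rewrite rules in both orientations.\<close>
    note neq = dist[simplified] dist_rev[simplified]
    fix i j k l :: nat assume "i < 3" "j < 3" "k < 3" "l < 3"
    then have "i \<in> {0, 1, 2}" "j \<in> {0, 1, 2}" "k \<in> {0, 1, 2}" "l \<in> {0, 1, 2}" by auto
    then show "adj (?g (i, j)) (?g (k, l)) \<longleftrightarrow> (i, j) \<noteq> (k, l) \<and> (i = k \<or> j = l)"
      by (elim insertE emptyE; hypsubst) (simp_all add: adj_iff neq)
  qed
qed

end

theorem theorem4p3:
  fixes G :: "'a pair_pre_digraph"
  assumes "pair_graph G"
    and "Digraph_Component.connected (with_proj G)"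
    and "irreducible_graph G"
    and "well_covered G"
    and "CIS G"
    and "clique_number G \<le> 3"
  shows "graph_iso G (complete_graph 1) \<or>
         graph_iso G (complete_graph 2) \<or>
         graph_iso G (complete_graph 3) \<or>
         graph_iso G (line_graph (complete_bipartite_graph 3 3))"
proof -
  interpret pair_graph G by fact
  interpret well_covered_CIS_graph_clique_le3 G
    by unfold_locales (use assms in auto)
  show ?thesis
  proof (cases "\<exists>v s. adj v s \<and> nbhd G s \<subseteq> insert v (nbhd G v)")
    case True
    then show ?thesis using simplicial_imp_complete[OF assms(2)] by blast
  next
    case False
    then interpret simplicial_free_CIS_graph G by unfold_locales auto
    show ?thesis
    proof (cases "\<exists>u v. adj u v")
      case True
      then show ?thesis using line_graph_K33[OF assms(2)] by blast
    next
      case no_edge: False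
      have "pverts G \<noteq> {}"
        using assms(2) by (auto simp: connected_def strongly_connected_def)
      then obtain v where v: "v \<in> pverts G" by blast
      \<comment> \<open>Without edges a singleton is closed under adjacency.\<close>
      have "{v} = pverts G"
        by (rule connected_closed_eq_verts[OF assms(2)]) (use v no_edge in auto)
      then have "card (pverts G) = 1" "is_clique G (pverts G)"
        by (auto simp: is_clique_def dest: sym)
      then show ?thesis using graph_iso_complete_graph[OF assms(1)] by blast
    qed
  qed
qed

end
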